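(* Let $\alpha$ and $\beta$ be real numbers with $\max\{0,\beta\}\leq \alpha\leq \frac{3}{2}$. Then $$\gamma(G)\leq (2\alpha+1)\,s\ell(G)-2\beta$$ for every graph $G$ in ${\cal G}(\alpha,\beta)$.
   Context: All graphs are finite, simple, and undirected; $n(H)$ denotes the order of a graph $H$, and a graph is non-null if its order is at least $1$. For real numbers $\alpha\geq 0$ and $\beta$, ${\cal G}(\alpha,\beta)$ is the class of non-null graphs $G$ such that every non-null subgraph $H$ of $G$ has at most $\alpha n(H)-\beta$ edges. A set $D\subseteq V(G)$ is a dominating set of $G$ if every vertex in $V(G)\setminus D$ has a neighbor in $D$; the domination number $\gamma(G)$ is the minimum order of a dominating set of $G$. For a graph $G$ of order $n\geq 1$ with non-increasing degree sequence $d_1\geq \ldots\geq d_n$, the Slater number is $s\ell(G)=\min\{ s: (d_1+1)+\cdots+(d_s+1)\geq n\}$, the minimum being over positive integers $s$. *)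

theory Defs
  imports Complex_Main "HOL-Library.Multiset"
begin

text \<open>A graph is a pair of a vertex set and a set of edges; an edge is the set of its two ends.\<close>

type_synonym 'a ugraph = "'a set \<times> 'a set set"

abbreviation verts :: "'a ugraph \<Rightarrow> 'a set" where
  "verts G \<equiv> fst G"

abbreviation edges :: "'a ugraph \<Rightarrow> 'a set set" where
  "edges G \<equiv> snd G"

definition simple_graph :: "'a ugraph \<Rightarrow> bool" where
  "simple_graph G \<longleftrightarrow> finite (verts G) \<and> (\<forall>e\<in>edges G. e \<subseteq> verts G \<and> card e = 2)"

definition graph_order :: "'a ugraph \<Rightarrow> nat" where
  "graph_order G = card (verts G)"

definition subgraph :: "'a ugraph \<Rightarrow> 'a ugraph \<Rightarrow> bool" where
  "subgraph H G \<longleftrightarrow> simple_graph H \<and> verts H \<subseteq> verts G \<and> edges H \<subseteq> edges G"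

definition sparse_graphs :: "real \<Rightarrow> real \<Rightarrow> 'a ugraph set" where
  "sparse_graphs \<alpha> \<beta> =
    {G. simple_graph G \<and> graph_order G \<ge> 1 \<and>
        (\<forall>H. subgraph H G \<and> graph_order H \<ge> 1 \<longrightarrow>
          real (card (edges H)) \<le> \<alpha> * real (graph_order H) - \<beta>)}"

definition neighbors :: "'a ugraph \<Rightarrow> 'a \<Rightarrow> 'a set" where
  "neighbors G v = {u \<in> verts G. {u, v} \<in> edges G}"

definition degree :: "'a ugraph \<Rightarrow> 'a \<Rightarrow> nat" where
  "degree G v = card (neighbors G v)"

definition dominating_set :: "'a ugraph \<Rightarrow> 'a set \<Rightarrow> bool" where
  "dominating_set G D \<longleftrightarrow>
    D \<subseteq> verts G \<and> (\<forall>v \<in> verts G - D. neighbors G v \<inter> D \<noteq> {})"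

definition domination_number :: "'a ugraph \<Rightarrow> nat" where
  "domination_number G = Min (card ` {D. dominating_set G D})"

definition degree_sequence :: "'a ugraph \<Rightarrow> nat list" where
  "degree_sequence G =
    rev (sorted_list_of_multiset (image_mset (degree G) (mset_set (verts G))))"

text \<open>Lists are indexed from 0, so the first \<open>s\<close> degrees are the entries at positions \<open>i < s\<close>.
  The bound \<open>s \<le> graph_order G\<close> keeps these positions within the list; \<open>s = graph_order G\<close> always
  qualifies for a non-null graph.\<close>

definition slater_number :: "'a ugraph \<Rightarrow> nat" where
  "slater_number G =
    (LEAST s. 1 \<le> s \<and> s \<le> graph_order G \<and> (\<Sum>i<s. (degree_sequence G ! i + 1)) \<ge> graph_order G)"

end

theory Submission imports Defs begin

text \<open>
  Let \<open>X\<close> be a set of \<open>s\<close> vertices of largest degree, where \<open>s\<close> is the Slater number, let \<open>c v\<close> be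
  the number of neighbors of \<open>v\<close> in \<open>X\<close>, let \<open>U\<close> and \<open>Y\<close> consist of the vertices \<open>v\<close> outside \<open>X\<close>
  with \<open>c v = 0\<close> and \<open>c v \<ge> 2\<close>, and let \<open>m\<close> and \<open>k\<close> be the numbers of edges inside \<open>X\<close> and between
  \<open>X\<close> and \<open>Y\<close>.  Then \<open>X \<union> U\<close> is dominating, and double counting the degrees in \<open>X\<close> turns the
  definition of \<open>s\<close> into \<open>|U| + |Y| \<le> 2 m + k\<close>.  Sparsity gives \<open>m + k \<le> \<alpha> (s + |Y|) - \<beta>\<close>, hence
  \<open>|U| \<le> m + \<alpha> s - \<beta> + (\<alpha> - 1) |Y|\<close>.  Since \<open>k \<ge> 2 |Y|\<close>, sparsity also gives
  \<open>(2 - \<alpha>) |Y| \<le> \<alpha> s - \<beta> - m\<close>, and \<open>\<alpha> - 1 \<le> 2 - \<alpha>\<close> because \<open>\<alpha> \<le> 3/2\<close>; so \<open>|U| \<le> 2 \<alpha> s - 2 \<beta>\<close>.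
\<close>

lemma simple_graph_finite_verts: "simple_graph G \<Longrightarrow> finite (verts G)"
  by (simp add: simple_graph_def)

lemma finite_neighbors: "simple_graph G \<Longrightarrow> finite (neighbors G v)"
  by (simp add: simple_graph_def neighbors_def)

lemma simple_graph_finite_edges:
  assumes "simple_graph G"
  shows "finite (edges G)"
proof -
  have "edges G \<subseteq> Pow (verts G)" using assms by (auto simp: simple_graph_def)
  then show ?thesis using assms finite_subset by (auto simp: simple_graph_def)
qed

lemma domination_number_le:
  assumes "simple_graph G" "dominating_set G D"
  shows "domination_number G \<le> card D"
proof -
  have "{D. dominating_set G D} \<subseteq> Pow (verts G)" by (auto simp: dominating_set_def)
  then have "finite {D. dominating_set G D}"
    using simple_graph_finite_verts[OF assms(1)] finite_subset by blast
  then show ?thesis using assms(2) by (auto simp: domination_number_def intro!: Min_le)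
qed

text \<open>\<open>degree_sequence\<close> is built from a multiset of numbers; listing the vertices
  by non-increasing degree ties its entries back to distinct vertices.\<close>

lemma degree_sequence_eq_map:
  assumes "finite (verts G)"
  obtains vs where "set vs = verts G" "distinct vs" "degree_sequence G = map (degree G) vs"
proof -
  obtain l where l: "set l = verts G" "distinct l"
    using finite_distinct_list[OF assms] by blast
  define vs where "vs = rev (sort_key (degree G) l)"
  have "mset_set (verts G) = mset l"
    using l by (metis mset_set_set)
  then have "degree_sequence G = rev (sort (map (degree G) l))"
    by (simp add: degree_sequence_def flip: mset_map)
  also have "sort (map (degree G) l) = map (degree G) (sort_key (degree G) l)"
    by (rule properties_for_sort) simp_all
  finally have "degree_sequence G = map (degree G) vs" by (simp add: vs_def rev_map)
  then show ?thesis using that[of vs] l by (simp add: vs_def)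
qed

lemma slater_set_exists:
  assumes "simple_graph G" "graph_order G \<ge> 1"
  obtains X where "X \<subseteq> verts G" "card X = slater_number G" "slater_number G \<ge> 1"
    "(\<Sum>x\<in>X. degree G x + 1) \<ge> graph_order G"
proof -
  obtain vs where vs: "set vs = verts G" "distinct vs" "degree_sequence G = map (degree G) vs"
    using degree_sequence_eq_map[OF simple_graph_finite_verts[OF assms(1)]] .
  have len: "length vs = graph_order G"
    using vs distinct_card by (fastforce simp: graph_order_def)
  define P where "P s \<longleftrightarrow> 1 \<le> s \<and> s \<le> graph_order G
      \<and> (\<Sum>i<s. (degree_sequence G ! i + 1)) \<ge> graph_order G" for s
  \<comment> \<open>Every summand is at least 1, so the full length qualifies and the
    \<open>LEAST\<close> is attained.\<close>
  have "(\<Sum>i<graph_order G. 1) \<le> (\<Sum>i<graph_order G. (degree_sequence G ! i + 1))"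
    by (intro sum_mono) simp
  then have "P (graph_order G)" using assms(2) by (simp add: P_def)
  then have P: "P (slater_number G)"
    unfolding slater_number_def P_def by (rule LeastI)
  define X where "X = set (take (slater_number G) vs)"
  have s: "slater_number G \<le> length vs" using P by (simp add: P_def len)
  have inj: "inj_on ((!) vs) {..<slater_number G}"
    using vs(2) s by (auto simp: inj_on_def nth_eq_iff_index_eq)
  have X: "X = (!) vs ` {..<slater_number G}"
    using nth_image[OF s] by (simp add: X_def atLeast0LessThan)
  have "(\<Sum>x\<in>X. degree G x + 1) = (\<Sum>i<slater_number G. degree G (vs ! i) + 1)"
    by (simp only: X sum.reindex[OF inj] o_def)
  also have "\<dots> = (\<Sum>i<slater_number G. degree_sequence G ! i + 1)"
    using s by (intro sum.cong) (auto simp: vs(3))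
  finally have "(\<Sum>x\<in>X. degree G x + 1) \<ge> graph_order G" using P by (simp add: P_def)
  moreover have "card X = slater_number G" by (simp add: X card_image[OF inj])
  moreover have "X \<subseteq> verts G" using vs(1) set_take_subset by (fastforce simp: X_def)
  ultimately show ?thesis using that P by (simp add: P_def)
qed

text \<open>Double counting of the adjacent pairs with one vertex in \<open>X\<close> and the other
  anywhere in the graph.\<close>

lemma sum_degree_eq:
  assumes "simple_graph G" "X \<subseteq> verts G"
  shows "(\<Sum>x\<in>X. degree G x) = (\<Sum>v\<in>verts G. card (neighbors G v \<inter> X))"
proof -
  have fin: "finite (verts G)" "finite X"
    using assms finite_subset by (auto simp: simple_graph_def)
  have "(\<Sum>x\<in>X. degree G x) = (\<Sum>x\<in>X. \<Sum>v\<in>{v\<in>verts G. {v, x} \<in> edges G}. 1)"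
    by (simp add: degree_def neighbors_def)
  also have "\<dots> = (\<Sum>v\<in>verts G. \<Sum>x\<in>{x\<in>X. {v, x} \<in> edges G}. 1)"
    by (rule sum.swap_restrict[OF fin(2,1)])
  also have "\<dots> = (\<Sum>v\<in>verts G. card (neighbors G v \<inter> X))"
    using assms(2) by (intro sum.cong) (auto simp: neighbors_def insert_commute intro!: arg_cong[of _ _ card])
  finally show ?thesis .
qed

lemma inj_on_edge: "inj_on (\<lambda>u. {u, v}) A"
  by (auto simp: inj_on_def doubleton_eq_iff)

lemma edge_image_neighbors:
  assumes "simple_graph G" "X \<subseteq> verts G" "v \<in> X"
  shows "{e \<in> edges G. e \<subseteq> X \<and> v \<in> e} = (\<lambda>u. {u, v}) ` (neighbors G v \<inter> X)"
proof (intro equalityI subsetI)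
  fix e assume e: "e \<in> {e \<in> edges G. e \<subseteq> X \<and> v \<in> e}"
  then have "card e = 2" using assms(1) by (auto simp: simple_graph_def)
  then obtain u where "e = {u, v}" using e by (auto simp: card_2_iff insert_commute)
  then show "e \<in> (\<lambda>u. {u, v}) ` (neighbors G v \<inter> X)"
    using e assms(2) by (auto simp: neighbors_def)
qed (use assms in \<open>auto simp: neighbors_def\<close>)

text \<open>The handshaking lemma for the subgraph induced by \<open>X\<close>: each edge inside
  \<open>X\<close> is counted once at each of its two ends.\<close>

lemma handshake:
  assumes "simple_graph G" "X \<subseteq> verts G"
  shows "(\<Sum>v\<in>X. card (neighbors G v \<inter> X)) = 2 * card {e \<in> edges G. e \<subseteq> X}"
proof -
  let ?E = "{e \<in> edges G. e \<subseteq> X}"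
  have fin: "finite ?E" "finite X"
    using simple_graph_finite_edges[OF assms(1)] assms finite_subset by (auto simp: simple_graph_def)
  have "card (neighbors G v \<inter> X) = card {e \<in> ?E. v \<in> e}" if "v \<in> X" for v
    using edge_image_neighbors[OF assms that] by (simp add: card_image[OF inj_on_edge] conj_assoc)
  then have "(\<Sum>v\<in>X. card (neighbors G v \<inter> X)) = (\<Sum>v\<in>X. card {e \<in> ?E. v \<in> e})"
    by simp
  also have "\<dots> = 2 * card ?E"
  proof (rule sum_multicount[OF fin(2,1)], intro ballI)
    fix e assume "e \<in> ?E"
    then have "{v \<in> X. v \<in> e} = e" "card e = 2" using assms(1) by (auto simp: simple_graph_def)
    then show "card {v \<in> X. v \<in> e} = 2" by simp
  qed
  finally show ?thesis .
qed

text \<open>Each such edge has exactly one end in \<open>Y\<close>, so the stars from different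
  vertices of \<open>Y\<close> into \<open>X\<close> share no edge.\<close>

lemma card_cross_edges:
  assumes "simple_graph G" "finite Y" "X \<inter> Y = {}"
  shows "card (\<Union>v\<in>Y. (\<lambda>u. {u, v}) ` (neighbors G v \<inter> X))
    = (\<Sum>v\<in>Y. card (neighbors G v \<inter> X))"
proof -
  have "card (\<Union>v\<in>Y. (\<lambda>u. {u, v}) ` (neighbors G v \<inter> X))
    = (\<Sum>v\<in>Y. card ((\<lambda>u. {u, v}) ` (neighbors G v \<inter> X)))"
    using assms finite_neighbors[OF assms(1)]
    by (intro card_UN_disjoint) (auto simp: doubleton_eq_iff)
  then show ?thesis by (simp add: card_image[OF inj_on_edge])
qed

text \<open>Sparsity applied to the subgraph \<open>(W, F)\<close>. It need not be induced, so edges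
  inside \<open>Y\<close> can later be left out.\<close>

lemma card_subgraph_edges_le:
  assumes "G \<in> sparse_graphs \<alpha> \<beta>" "W \<subseteq> verts G" "W \<noteq> {}"
    and "F \<subseteq> edges G" "\<And>e. e \<in> F \<Longrightarrow> e \<subseteq> W"
  shows "real (card F) \<le> \<alpha> * real (card W) - \<beta>"
proof -
  have G: "simple_graph G" using assms(1) by (simp add: sparse_graphs_def)
  then have "finite W" using assms(2) finite_subset by (auto simp: simple_graph_def)
  then have "subgraph (W, F) G" "graph_order (W, F) \<ge> 1"
    using assms G by (auto simp: subgraph_def simple_graph_def graph_order_def Suc_le_eq card_gt_0_iff)
  then show ?thesis using assms(1) by (fastforce simp: sparse_graphs_def graph_order_def)
qed

text \<open>The counting argument for an arbitrary \<open>X\<close> satisfying the Slater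
  inequality; the Slater number enters only through the choice of \<open>X\<close>.\<close>

lemma domination_number_le_of_cover:
  fixes \<alpha> \<beta> :: real
  assumes "\<alpha> \<le> 3 / 2" "G \<in> sparse_graphs \<alpha> \<beta>"
    and X: "X \<subseteq> verts G" "X \<noteq> {}" "(\<Sum>x\<in>X. degree G x + 1) \<ge> graph_order G"
  shows "real (domination_number G) \<le> (2 * \<alpha> + 1) * real (card X) - 2 * \<beta>"
proof -
  have G: "simple_graph G" using assms(2) by (simp add: sparse_graphs_def)
  have fV: "finite (verts G)" by (rule simple_graph_finite_verts[OF G])
  have fX: "finite X" using X(1) fV finite_subset by blast
  define c where "c v = card (neighbors G v \<inter> X)" for v
  define U where "U = {v \<in> verts G - X. c v = 0}"
  define Y1 where "Y1 = {v \<in> verts G - X. c v = 1}"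
  define Y where "Y = {v \<in> verts G - X. c v \<ge> 2}"
  define E1 where "E1 = {e \<in> edges G. e \<subseteq> X}"
  define E2 where "E2 = (\<Union>v\<in>Y. (\<lambda>u. {u, v}) ` (neighbors G v \<inter> X))"
  have V: "verts G = X \<union> (U \<union> (Y1 \<union> Y))"
    using X(1) by (auto simp: U_def Y1_def Y_def)
  have fin: "finite U" "finite Y1" "finite Y" using fV by (auto simp: U_def Y1_def Y_def)
  have split_sum: "sum f (verts G) = sum f X + (sum f U + (sum f Y1 + sum f Y))"
    for f :: "'a \<Rightarrow> nat"
  proof -
    have "sum f (Y1 \<union> Y) = sum f Y1 + sum f Y"
      using fin by (intro sum.union_disjoint) (auto simp: Y1_def Y_def)
    moreover have "sum f (U \<union> (Y1 \<union> Y)) = sum f U + sum f (Y1 \<union> Y)"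
      using fin by (intro sum.union_disjoint) (auto simp: U_def Y1_def Y_def)
    moreover have "sum f (verts G) = sum f X + sum f (U \<union> (Y1 \<union> Y))"
      unfolding V using fin fX by (intro sum.union_disjoint) (auto simp: U_def Y1_def Y_def)
    ultimately show ?thesis by simp
  qed

  have "dominating_set G (X \<union> U)"
    using X(1) fX by (auto simp: dominating_set_def U_def c_def)
  then have dom: "domination_number G \<le> card X + card U"
    using domination_number_le[OF G] card_Un_le[of X U] le_trans by blast

  have cX: "sum c X = 2 * card E1"
    using handshake[OF G X(1)] by (simp add: c_def E1_def)
  have cY: "sum c Y = card E2"
    unfolding E2_def c_def using fin by (subst card_cross_edges[OF G]) (auto simp: Y_def)
  have cU: "sum c U = 0" by (simp add: U_def)
  have cY1: "sum c Y1 = card Y1" by (simp add: Y1_def)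
  \<comment> \<open>On comparing this bound with the order, the terms \<open>card X\<close> and
    \<open>card Y1\<close> cancel, since each vertex of \<open>Y1\<close> counts once on both
    sides.\<close>
  have "graph_order G \<le> sum c (verts G) + card X"
    using X(3) sum_degree_eq[OF G X(1)] by (simp add: sum_Suc c_def)
  moreover have "graph_order G = card X + (card U + (card Y1 + card Y))"
    using split_sum[of "\<lambda>_. 1"] by (simp add: graph_order_def)
  ultimately have undom: "card U + card Y \<le> 2 * card E1 + card E2"
    using split_sum[of c] cX cY cU cY1 by simp
  have "(\<Sum>v\<in>Y. 2) \<le> sum c Y" by (intro sum_mono) (simp add: Y_def)
  then have E2_ge: "2 * card Y \<le> card E2" by (simp add: cY)

  have E2_sub: "E2 \<subseteq> edges G" by (auto simp: E2_def neighbors_def)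
  have "E1 \<inter> E2 = {}" by (auto simp: E1_def E2_def Y_def)
  moreover have "finite E1" "finite E2"
    using simple_graph_finite_edges[OF G] E2_sub finite_subset by (auto simp: E1_def)
  ultimately have "card (E1 \<union> E2) = card E1 + card E2" by (rule card_Un_disjoint[rotated 2])
  moreover have "card (X \<union> Y) = card X + card Y"
    using fX fin by (intro card_Un_disjoint) (auto simp: Y_def)
  moreover have "real (card (E1 \<union> E2)) \<le> \<alpha> * real (card (X \<union> Y)) - \<beta>"
    using X E2_sub by (intro card_subgraph_edges_le[OF assms(2)]) (auto simp: E1_def E2_def Y_def)
  ultimately have sparse:
    "real (card E1) + real (card E2) \<le> \<alpha> * real (card X) + \<alpha> * real (card Y) - \<beta>"
    by (simp add: distrib_left)
  have "\<alpha> * real (card Y) \<le> 3 / 2 * real (card Y)"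
    using assms(1) by (intro mult_right_mono) simp_all
  moreover have "real (card U) + real (card Y) \<le> 2 * real (card E1) + real (card E2)"
    using undom by linarith
  moreover have "2 * real (card Y) \<le> real (card E2)" using E2_ge by linarith
  moreover have "real (domination_number G) \<le> real (card X) + real (card U)"
    using dom by linarith
  \<comment> \<open>With x, y, u, m, k the sizes of \<open>X\<close>, \<open>Y\<close>,
    \<open>U\<close>, \<open>E1\<close>, \<open>E2\<close>, doubling \<open>sparse\<close> gives u
    \<le> 2m + k - y \<le> 2\<alpha>x - 2\<beta> + (2\<alpha>y - k - y), and the bracket is at most
    3y - 2y - y = 0.\<close>
  ultimately have "real (domination_number G) \<le> real (card X) + 2 * (\<alpha> * real (card X)) - 2 * \<beta>"
    using sparse by linarith
  then show ?thesis by (simp add: algebra_simps)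
qed

theorem theorem4:
  fixes \<alpha> \<beta> :: real and G :: "'a ugraph"
  assumes "max 0 \<beta> \<le> \<alpha>" and "\<alpha> \<le> 3 / 2"
    and "G \<in> sparse_graphs \<alpha> \<beta>"
  shows "real (domination_number G) \<le> (2 * \<alpha> + 1) * real (slater_number G) - 2 * \<beta>"
proof -
  have "simple_graph G" "graph_order G \<ge> 1"
    using assms(3) by (simp_all add: sparse_graphs_def)
  then obtain X where X: "X \<subseteq> verts G" "card X = slater_number G" "slater_number G \<ge> 1"
    "(\<Sum>x\<in>X. degree G x + 1) \<ge> graph_order G"
    by (rule slater_set_exists)
  from X(2,3) have "X \<noteq> {}" by auto
  from domination_number_le_of_cover[OF assms(2,3) X(1) this X(4)] show ?thesis
    by (simp add: X(2))
qed

end
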